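(* Let $K\neq\{0\}$ be a uniformly convex subset of a Banach space $X$ and let $Z$ be a subspace of $X^*$. Then: (a) the set of extreme points of $K$ equals the set of denting points of $K$; (b) the set of $Z$-exposed points of $K$, the set of $Z$-strongly exposed points of $K$, and the set $\{x\in K: \exists\, x^*\in Z \text{ with } \sup_K x^*=x^*(x)>0\}$ all coincide.
   Context: Banach spaces are real. A symmetric bounded closed convex subset $C$ of a Banach space is uniformly convex if for every $\varepsilon>0$ there is $\delta\in(0,1)$ such that for all $x,y\in C$ with $\|x-y\|>\varepsilon$ one has $\frac{x+y}{2}\in(1-\delta)C$. For a bounded convex set $C\subset X$, a slice of $C$ is a set $S(C,x^*,\alpha)=\{x\in C: x^*(x)>\sup_C x^*-\alpha\}$ with $x^*\in X^*$, $\alpha>0$. A point $x\in C$ is denting if for every $\varepsilon>0$ there is a slice of $C$ containing $x$ of diameter less than $\varepsilon$. A point $x\in C$ is $Z$-exposed if there is $x^*\in Z$ with $x^*(x)>x^*(y)$ for all $y\in C\setminus\{x\}$ ($x^*$ exposes $x$). It is $Z$-strongly exposed if there is $x^*\in Z$ exposing $x$ such that every sequence $(x_n)$ in $C$ with $x^*(x_n)\to x^*(x)$ converges in norm to $x$. *)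

theory Defs
  imports "HOL-Analysis.Analysis"
begin

text \<open>The topological dual of \<open>'a\<close> is the type \<open>'a \<Rightarrow>\<^sub>L real\<close> of bounded linear functionals.\<close>

definition uniformly_convex_set :: "'a::real_normed_vector set \<Rightarrow> bool" where
  "uniformly_convex_set C \<longleftrightarrow>
     (\<forall>x\<in>C. - x \<in> C) \<and> bounded C \<and> closed C \<and> convex C \<and>
     (\<forall>\<epsilon>>0. \<exists>\<delta>. 0 < \<delta> \<and> \<delta> < 1 \<and>
        (\<forall>x\<in>C. \<forall>y\<in>C. norm (x - y) > \<epsilon> \<longrightarrow>
           (1 / 2) *\<^sub>R (x + y) \<in> (\<lambda>z. (1 - \<delta>) *\<^sub>R z) ` C))"

text \<open>The supremum is the real-valued one, so this is meaningful only for bounded \<open>C\<close>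
  (for empty \<open>C\<close> the slice is empty whatever the value of the supremum);
  the same applies to \<open>diameter\<close> below.\<close>

definition slice :: "'a::real_normed_vector set \<Rightarrow> ('a \<Rightarrow>\<^sub>L real) \<Rightarrow> real \<Rightarrow> 'a set" where
  "slice C f \<alpha> = {x \<in> C. blinfun_apply f x > (SUP y\<in>C. blinfun_apply f y) - \<alpha>}"

definition denting_point :: "'a::real_normed_vector \<Rightarrow> 'a set \<Rightarrow> bool" where
  "denting_point x C \<longleftrightarrow>
     x \<in> C \<and> (\<forall>\<epsilon>>0. \<exists>f \<alpha>. \<alpha> > 0 \<and> x \<in> slice C f \<alpha> \<and> diameter (slice C f \<alpha>) < \<epsilon>)"

definition exposes :: "('a::real_normed_vector \<Rightarrow>\<^sub>L real) \<Rightarrow> 'a \<Rightarrow> 'a set \<Rightarrow> bool" where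
  "exposes f x C \<longleftrightarrow> x \<in> C \<and> (\<forall>y\<in>C - {x}. blinfun_apply f x > blinfun_apply f y)"

definition exposed_point :: "('a::real_normed_vector \<Rightarrow>\<^sub>L real) set \<Rightarrow> 'a \<Rightarrow> 'a set \<Rightarrow> bool" where
  "exposed_point Z x C \<longleftrightarrow> (\<exists>f\<in>Z. exposes f x C)"

definition strongly_exposed_point ::
    "('a::real_normed_vector \<Rightarrow>\<^sub>L real) set \<Rightarrow> 'a \<Rightarrow> 'a set \<Rightarrow> bool" where
  "strongly_exposed_point Z x C \<longleftrightarrow>
     (\<exists>f\<in>Z. exposes f x C \<and>
        (\<forall>s :: nat \<Rightarrow> 'a. (\<forall>n. s n \<in> C) \<longrightarrow>
           (\<lambda>n. blinfun_apply f (s n)) \<longlonglongrightarrow> blinfun_apply f x \<longrightarrow> s \<longlonglongrightarrow> x))"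

end

theory Submission
  imports Defs
begin

text \<open>If \<open>y, z\<close> lie in the slice of \<open>K\<close> of width \<open>\<delta> \<cdot> sup f\<close>, then \<open>f ((y + z) / 2) > (1 - \<delta>) sup f\<close>,
  so \<open>(y + z) / 2\<close> is outside \<open>(1 - \<delta>) K\<close> and uniform convexity bounds \<open>norm (y - z)\<close> uniformly
  in \<open>f\<close>. Hence a functional with positive supremum strongly exposes every point where it attains it.
  A nonzero extreme point lies in no \<open>(1 - \<delta>) K\<close>; separating it from that closed convex set by
  Hahn--Banach puts it into a slice of small diameter. The Hahn--Banach theorem is obtained
  from the fact that a minimal sublinear functional is linear.\<close>

section \<open>Sublinear functionals and separation\<close>

text \<open>Only \<open>\<le>\<close> is demanded in the homogeneity condition: equality follows for \<open>c > 0\<close> by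
  using \<open>1 / c\<close>, and \<open>q 0 = 0\<close> follows with subadditivity.\<close>

definition sublinear :: "('a::real_vector \<Rightarrow> real) \<Rightarrow> bool" where
  "sublinear q \<longleftrightarrow> (\<forall>x y. q (x + y) \<le> q x + q y) \<and> (\<forall>c\<ge>0. \<forall>x. q (c *\<^sub>R x) \<le> c * q x)"

lemma sublinear_add: "sublinear q \<Longrightarrow> q (x + y) \<le> q x + q y"
  by (simp add: sublinear_def)

lemma sublinear_scaleR_le: "sublinear q \<Longrightarrow> 0 \<le> c \<Longrightarrow> q (c *\<^sub>R x) \<le> c * q x"
  by (simp add: sublinear_def)

lemma sublinear_zero:
  assumes "sublinear q"
  shows "q 0 = 0"
  using sublinear_scaleR_le[OF assms, of 0 0] sublinear_add[OF assms, of 0 0] by simp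

lemma sublinear_scaleR:
  assumes "sublinear q" "0 \<le> c"
  shows "q (c *\<^sub>R x) = c * q x"
proof (cases "c = 0")
  case True
  then show ?thesis by (simp add: sublinear_zero[OF assms(1)])
next
  case False
  then have c: "c > 0" using assms(2) by simp
  have "q x \<le> (1 / c) * q (c *\<^sub>R x)"
    using sublinear_scaleR_le[OF assms(1), of "1 / c" "c *\<^sub>R x"] c by simp
  then have "c * q x \<le> q (c *\<^sub>R x)" using c by (simp add: field_simps)
  then show ?thesis using sublinear_scaleR_le[OF assms, of x] by simp
qed

lemma sublinear_minus_le:
  assumes "sublinear q"
  shows "- q (- x) \<le> q x"
  using sublinear_add[OF assms, of x "- x"] sublinear_zero[OF assms] by simp

text \<open>The witness is \<open>r x\<close> = inf of \<open>q (x - t *\<^sub>R a) - t * d\<close>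
  over \<open>t \<ge> 0\<close> and \<open>a \<in> A\<close>. Putting \<open>x = a\<close> in the
  last conclusion gives \<open>r a \<le> - d\<close>, so every linear functional below
  \<open>r\<close> is at most \<open>- d\<close> on \<open>A\<close>. A singleton \<open>A\<close>
  later yields additivity of minimal functionals, a translate of a convex set yields
  separation.\<close>

lemma sublinear_shift:
  fixes q :: "'a::real_vector \<Rightarrow> real"
  assumes q: "sublinear q" and A: "convex A" "A \<noteq> {}" and d: "\<And>a. a \<in> A \<Longrightarrow> d \<le> q (- a)"
  obtains r where "sublinear r" "r \<le> q" "\<And>x a. a \<in> A \<Longrightarrow> r x \<le> q (x - a) - d"
proof -
  define g where "g = (\<lambda>x (t, a). q (x - t *\<^sub>R a) - t * d)"
  define I where "I = {0::real..} \<times> A"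
  define r where "r = (\<lambda>x. INF p\<in>I. g x p)"
  have I: "I \<noteq> {}" using A by (auto simp: I_def)
  \<comment> \<open>This bound does not depend on \<open>p\<close>, so the infimum is finite; here
    the hypothesis \<open>d \<le> q (- a)\<close> enters.\<close>
  have lb: "- q (- x) \<le> g x p" if p: "p \<in> I" for x p
  proof -
    obtain t a where p': "p = (t, a)" "t \<ge> 0" "a \<in> A" using p by (auto simp: I_def)
    have "t * d \<le> t * q (- a)" using d[OF p'(3)] p'(2) by (rule mult_left_mono)
    also have "\<dots> = q (- x + (x - t *\<^sub>R a))" using sublinear_scaleR[OF q p'(2), of "- a"] by simp
    also have "\<dots> \<le> q (- x) + q (x - t *\<^sub>R a)" by (rule sublinear_add[OF q])
    finally show ?thesis by (simp add: g_def p')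
  qed
  have bdd: "bdd_below (g x ` I)" for x using lb by (rule bdd_belowI2)
  have le: "r x \<le> g x p" if "p \<in> I" for x p
    unfolding r_def using bdd that by (rule cINF_lower)
  have "r (x + y) \<le> r x + r y" for x y
  proof -
    have "r (x + y) - g x p \<le> r y" if p: "p \<in> I" for p
    proof -
      have "r (x + y) - g x p \<le> g y p'" if p': "p' \<in> I" for p'
      proof -
        obtain t a where ta: "p = (t, a)" "t \<ge> 0" "a \<in> A" using p by (auto simp: I_def)
        obtain s b where sb: "p' = (s, b)" "s \<ge> 0" "b \<in> A" using p' by (auto simp: I_def)
        \<comment> \<open>Convexity of \<open>A\<close> merges the two shifts into the single shift
          \<open>(t + s, c)\<close>, which competes in the infimum at \<open>x + y\<close>. If
          \<open>t + s = 0\<close>, any point of \<open>A\<close> serves as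
          \<open>c\<close>.\<close>
        obtain c where c: "c \<in> A" "(t + s) *\<^sub>R c = t *\<^sub>R a + s *\<^sub>R b"
        proof (cases "t + s = 0")
          case True
          then have "t = 0" "s = 0" using ta sb by auto
          then show ?thesis using that[of a] ta by simp
        next
          case False
          then have pos: "t + s > 0" using ta sb by simp
          have "(t / (t + s)) *\<^sub>R a + (s / (t + s)) *\<^sub>R b \<in> A"
            using pos ta sb by (intro convexD[OF A(1)]) (auto simp flip: add_divide_distrib)
          then show ?thesis using that pos by (auto simp: scaleR_add_right)
        qed
        have "r (x + y) \<le> q (x + y - (t + s) *\<^sub>R c) - (t + s) * d"
          using le[of "(t + s, c)" "x + y"] c ta sb by (simp add: I_def g_def)
        also have "x + y - (t + s) *\<^sub>R c = (x - t *\<^sub>R a) + (y - s *\<^sub>R b)"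
          by (simp add: c(2))
        also have "q \<dots> \<le> q (x - t *\<^sub>R a) + q (y - s *\<^sub>R b)" by (rule sublinear_add[OF q])
        finally show ?thesis by (simp add: g_def ta sb algebra_simps)
      qed
      then show ?thesis unfolding r_def[THEN fun_cong, of y] using I by (intro cINF_greatest)
    qed
    then have "r (x + y) - r y \<le> g x p" if "p \<in> I" for p using that by (simp add: algebra_simps)
    then have "r (x + y) - r y \<le> r x" unfolding r_def[THEN fun_cong, of x] using I by (intro cINF_greatest)
    then show ?thesis by simp
  qed
  moreover have le_q: "r x \<le> q x" for x
  proof -
    obtain a where "a \<in> A" using A by auto
    then show ?thesis using le[of "(0, a)" x] by (simp add: I_def g_def)
  qed
  moreover have "r (c *\<^sub>R x) \<le> c * r x" if c: "c \<ge> 0" for c x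
  proof (cases "c = 0")
    case True
    then show ?thesis using le_q[of 0] sublinear_zero[OF q] by simp
  next
    case False
    \<comment> \<open>The pair \<open>(t, a)\<close> at \<open>x\<close> corresponds to
      \<open>(c * t, a)\<close> at \<open>c *\<^sub>R x\<close>.\<close>
    have "r (c *\<^sub>R x) / c \<le> g x p" if p: "p \<in> I" for p
    proof -
      obtain t a where ta: "p = (t, a)" "t \<ge> 0" "a \<in> A" using p by (auto simp: I_def)
      have "r (c *\<^sub>R x) \<le> q (c *\<^sub>R x - (c * t) *\<^sub>R a) - c * t * d"
        using le[of "(c * t, a)" "c *\<^sub>R x"] c ta by (simp add: I_def g_def)
      also have "c *\<^sub>R x - (c * t) *\<^sub>R a = c *\<^sub>R (x - t *\<^sub>R a)" by (simp add: algebra_simps)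
      also have "q \<dots> = c * q (x - t *\<^sub>R a)" by (rule sublinear_scaleR[OF q c])
      finally show ?thesis using c False by (simp add: g_def ta field_simps)
    qed
    then have "r (c *\<^sub>R x) / c \<le> r x" unfolding r_def[THEN fun_cong, of x] using I by (intro cINF_greatest)
    then show ?thesis using c False by (simp add: field_simps)
  qed
  ultimately have "sublinear r" "r \<le> q" by (auto simp: sublinear_def le_fun_def)
  moreover have "r x \<le> q (x - a) - d" if "a \<in> A" for x a
    using le[of "(1, a)" x] that by (simp add: I_def g_def)
  ultimately show ?thesis using that by blast
qed

text \<open>Shifting \<open>q\<close> along \<open>{- y}\<close> with \<open>d = q y\<close> gives a
  sublinear functional below \<open>q\<close>, which by minimality is \<open>q\<close> itself. The
  resulting \<open>q x \<le> q (x + y) - q y\<close> is the reverse of subadditivity.\<close>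

lemma sublinear_minimal_linear:
  assumes q: "sublinear q" and min: "\<And>r. sublinear r \<Longrightarrow> r \<le> q \<Longrightarrow> r = q"
  shows "linear q"
proof -
  have add: "q (x + y) = q x + q y" for x y
  proof -
    obtain r where r: "sublinear r" "r \<le> q" "\<And>x a. a \<in> {- y} \<Longrightarrow> r x \<le> q (x - a) - q y"
      by (rule sublinear_shift[OF q, of "{- y}" "q y"]) auto
    have "q x \<le> q (x + y) - q y" using r(3)[of "- y" x] min[OF r(1,2)] by simp
    then show ?thesis using sublinear_add[OF q, of x y] by simp
  qed
  have minus: "q (- x) = - q x" for x
    using add[of x "- x"] sublinear_zero[OF q] by simp
  have "q (c *\<^sub>R x) = c *\<^sub>R q x" for c x
  proof (cases "c \<ge> 0")
    case False
    then show ?thesis using sublinear_scaleR[OF q, of "- c" x] minus[of "c *\<^sub>R x"] by simp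
  qed (simp add: sublinear_scaleR[OF q])
  then show ?thesis using add by (intro linearI) auto
qed

text \<open>Of two members \<open>q\<close>, \<open>r\<close> of the chain the smaller one,
  \<open>m\<close>, gives \<open>m (x + y) \<le> m x + m y \<le> q x + r y\<close>; the infima over
  \<open>q\<close> and \<open>r\<close> can then be taken separately.\<close>

lemma sublinear_INF_chain:
  fixes C :: "('a::real_vector \<Rightarrow> real) set"
  assumes C: "C \<noteq> {}" "\<And>q. q \<in> C \<Longrightarrow> sublinear q" "\<And>q r. q \<in> C \<Longrightarrow> r \<in> C \<Longrightarrow> q \<le> r \<or> r \<le> q"
    and bdd: "\<And>x. bdd_below ((\<lambda>q. q x) ` C)"
  shows "sublinear (\<lambda>x. INF q\<in>C. q x)"
proof -
  define u where "u = (\<lambda>x. INF q\<in>C. q x)"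
  have le: "u x \<le> q x" if "q \<in> C" for x q
    unfolding u_def using bdd that by (rule cINF_lower)
  have "u (x + y) \<le> u x + u y" for x y
  proof -
    have *: "u (x + y) \<le> q x + r y" if qr: "q \<in> C" "r \<in> C" for q r
    proof -
      obtain m where m: "m \<in> C" "m \<le> q" "m \<le> r" using C(3)[OF qr] qr by auto
      have "u (x + y) \<le> m x + m y"
        using le[OF m(1), of "x + y"] sublinear_add[OF C(2)[OF m(1)], of x y] by simp
      then show ?thesis using m(2,3) by (smt (verit) le_funD)
    qed
    have "u (x + y) - q x \<le> u y" if "q \<in> C" for q
      unfolding u_def[THEN fun_cong, of y] using C(1) *[OF that] by (intro cINF_greatest) (auto simp: algebra_simps)
    then have "u (x + y) - u y \<le> u x"
      unfolding u_def[THEN fun_cong, of x] using C(1) by (intro cINF_greatest) (auto simp: algebra_simps)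
    then show ?thesis by simp
  qed
  moreover have "u (c *\<^sub>R x) \<le> c * u x" if c: "c \<ge> 0" for c x
  proof (cases "c = 0")
    case True
    obtain q where "q \<in> C" using C(1) by auto
    then show ?thesis using True le[of q 0] sublinear_zero[OF C(2), of q] by simp
  next
    case False
    have "u (c *\<^sub>R x) / c \<le> q x" if "q \<in> C" for q
      using le[OF that, of "c *\<^sub>R x"] sublinear_scaleR[OF C(2)[OF that] c, of x] c False
      by (simp add: field_simps)
    then have "u (c *\<^sub>R x) / c \<le> u x"
      unfolding u_def[THEN fun_cong, of x] using C(1) by (intro cINF_greatest) auto
    then show ?thesis using c False by (simp add: field_simps)
  qed
  ultimately show ?thesis unfolding u_def sublinear_def by auto
qed

theorem linear_below_sublinear:
  fixes p :: "'a::real_vector \<Rightarrow> real"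
  assumes p: "sublinear p"
  obtains f where "linear f" "f \<le> p"
proof -
  define S where "S = {q. sublinear q \<and> q \<le> p}"
  have "\<exists>m\<in>S. \<forall>a\<in>S. a \<le> m \<longrightarrow> a = m"
  \<comment> \<open>The order is reversed, so that a maximal element is a minimal sublinear
    functional.\<close>
  proof (rule predicate_Zorn[where P = "\<lambda>q r. r \<le> q"])
    show "partial_order_on S (relation_of (\<lambda>q r. r \<le> q) S)"
      by (rule partial_order_on_relation_ofI) auto
  next
    fix C assume "C \<in> Chains (relation_of (\<lambda>q r. r \<le> q) S)"
    then have C: "C \<subseteq> S" "\<And>q r. q \<in> C \<Longrightarrow> r \<in> C \<Longrightarrow> q \<le> r \<or> r \<le> q"
      by (auto simp: Chains_def relation_of_def)
    show "\<exists>u\<in>S. \<forall>a\<in>C. u \<le> a"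
    proof (cases "C = {}")
      case True
      then show ?thesis using p by (auto simp: S_def)
    next
      case False
      \<comment> \<open>All members of the chain share this lower bound, since
        \<open>- p (- x) \<le> - q (- x) \<le> q x\<close>.\<close>
      have "- p (- x) \<le> q x" if "q \<in> C" for q x
        using that C(1) sublinear_minus_le[of q x] le_funD[of q p "- x"] by (force simp: S_def)
      then have bdd: "bdd_below ((\<lambda>q. q x) ` C)" for x by (rule bdd_belowI2)
      define u where "u = (\<lambda>x. INF q\<in>C. q x)"
      have le: "u \<le> q" if "q \<in> C" for q
        unfolding u_def le_fun_def using bdd that by (auto intro: cINF_lower)
      have "sublinear u" unfolding u_def
        using False C bdd by (intro sublinear_INF_chain) (auto simp: S_def)
      moreover have "u \<le> p" using False C(1) le by (force simp: S_def intro: order_trans)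
      ultimately show ?thesis using le by (auto simp: S_def)
    qed
  qed
  then obtain m where m: "m \<in> S" "\<And>a. a \<in> S \<Longrightarrow> a \<le> m \<Longrightarrow> a = m" by blast
  have "linear m" using m by (intro sublinear_minimal_linear) (auto simp: S_def intro: order_trans)
  then show ?thesis using that m(1) by (auto simp: S_def)
qed

text \<open>The norm is shifted along the translate of \<open>C\<close> by \<open>- x\<close>, with
  \<open>d\<close> the distance from \<open>x\<close> to \<open>C\<close>. A linear \<open>f\<close>
  below the result is dominated by the norm, hence bounded, and satisfies
  \<open>f (y - x) \<le> - d\<close> on \<open>C\<close>.\<close>

theorem separation_point_closed_convex:
  fixes C :: "'a::real_normed_vector set"
  assumes C: "convex C" "closed C" "C \<noteq> {}" and x: "x \<notin> C"
  obtains f :: "'a \<Rightarrow>\<^sub>L real" and d where "0 < d" "\<And>y. y \<in> C \<Longrightarrow> blinfun_apply f y + d \<le> blinfun_apply f x"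
proof -
  define d where "d = infdist x C"
  have d: "d > 0" unfolding d_def using infdist_pos_not_in_closed C x by blast
  have norm: "sublinear (norm :: 'a \<Rightarrow> real)" by (simp add: sublinear_def norm_triangle_ineq)
  define A where "A = (\<lambda>y. - x + y) ` C"
  have dist: "d \<le> norm (- a)" if "a \<in> A" for a
  proof -
    obtain y where "y \<in> C" "a = - x + y" using \<open>a \<in> A\<close> by (auto simp: A_def)
    then show ?thesis using infdist_le[of y C x] by (simp add: d_def dist_norm)
  qed
  have "convex A" "A \<noteq> {}" using C by (auto simp: A_def intro: convex_translation)
  then obtain r where r: "sublinear r" "r \<le> norm" "\<And>x a. a \<in> A \<Longrightarrow> r x \<le> norm (x - a) - d"
    using sublinear_shift[OF norm _ _ dist] by metis
  obtain f where f: "linear f" "f \<le> r" using linear_below_sublinear[OF r(1)] .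
  have le: "f y \<le> norm y" for y using f(2) r(2) by (meson le_funD order_trans)
  have "\<bar>f y\<bar> \<le> norm y" for y
    using le[of y] le[of "- y"] linear_neg[OF f(1), of y] by simp
  then have bl: "bounded_linear f"
    using f(1) by (intro bounded_linear_intro[where K = 1]) (auto simp: linear_add linear_scale)
  have "f y + d \<le> f x" if "y \<in> C" for y
  proof -
    have "f (y - x) \<le> r (y - x)" using f(2) by (rule le_funD)
    also have "\<dots> \<le> - d" using r(3)[of "y - x" "y - x"] that by (auto simp: A_def)
    finally show ?thesis by (simp add: linear_diff[OF f(1)])
  qed
  then show ?thesis using that[of d "Blinfun f"] d by (simp add: bounded_linear_Blinfun_apply[OF bl])
qed

section \<open>Slices of uniformly convex sets\<close>

lemma bdd_above_blinfun_image:
  fixes f :: "'a::real_normed_vector \<Rightarrow>\<^sub>L real"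
  assumes "bounded C"
  shows "bdd_above (blinfun_apply f ` C)"
  using assms by (intro bounded_imp_bdd_above bounded_linear_image blinfun.bounded_linear_right)

text \<open>That \<delta> is chosen before \<open>f\<close> matters: for an extreme point the
  functional is found only afterwards, by separation from a set that depends on \<delta>.\<close>

lemma uniformly_convex_set_slice:
  assumes K: "uniformly_convex_set K" and "\<epsilon> > 0"
  obtains \<delta> where "0 < \<delta>" "\<delta> < 1"
    "\<And>f y z. y \<in> slice K f (\<delta> * (SUP w\<in>K. blinfun_apply f w)) \<Longrightarrow>
       z \<in> slice K f (\<delta> * (SUP w\<in>K. blinfun_apply f w)) \<Longrightarrow> norm (y - z) \<le> \<epsilon>"
proof -
  obtain \<delta> where \<delta>: "0 < \<delta>" "\<delta> < 1" and
    mid: "\<And>y z. y \<in> K \<Longrightarrow> z \<in> K \<Longrightarrow> norm (y - z) > \<epsilon> \<Longrightarrow>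
           (1 / 2) *\<^sub>R (y + z) \<in> (\<lambda>w. (1 - \<delta>) *\<^sub>R w) ` K"
    using K \<open>\<epsilon> > 0\<close> unfolding uniformly_convex_set_def by metis
  have "norm (y - z) \<le> \<epsilon>"
    if y: "y \<in> slice K f (\<delta> * (SUP w\<in>K. blinfun_apply f w))"
      and z: "z \<in> slice K f (\<delta> * (SUP w\<in>K. blinfun_apply f w))" for f y z
  proof (rule ccontr)
    let ?M = "SUP w\<in>K. blinfun_apply f w"
    assume "\<not> norm (y - z) \<le> \<epsilon>"
    then obtain w where w: "w \<in> K" "(1 / 2) *\<^sub>R (y + z) = (1 - \<delta>) *\<^sub>R w"
      using mid[of y z] y z by (auto simp: slice_def)
    have "bounded K" using K by (simp add: uniformly_convex_set_def)
    then have "f w \<le> ?M" using w(1) by (intro cSUP_upper bdd_above_blinfun_image)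
    then have "(1 - \<delta>) * f w \<le> (1 - \<delta>) * ?M" using \<delta> by (intro mult_left_mono) auto
    moreover have "(1 / 2) * (f y + f z) = (1 - \<delta>) * f w"
      using arg_cong[OF w(2), of f] by (simp add: blinfun.bilinear_simps)
    moreover have "f y > ?M - \<delta> * ?M" "f z > ?M - \<delta> * ?M" using y z by (auto simp: slice_def)
    ultimately show False by (simp add: algebra_simps)
  qed
  then show ?thesis using that \<delta> by blast
qed

section \<open>Extreme points and denting points\<close>

lemma real_vector_eq_minus_iff: "y = - y \<longleftrightarrow> y = 0" for y :: "'a::real_vector"
  by (simp add: eq_neg_iff_add_eq_0 flip: scaleR_2)

text \<open>A small slice around a point inside a segment misses both end points. The functional is
  then at most the threshold of the slice at both ends, hence at the point too.\<close>

lemma denting_point_imp_extreme_point: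
  assumes "bounded C" "denting_point x C"
  shows "x extreme_point_of C"
  unfolding extreme_point_of_def
proof (intro conjI ballI notI)
  show "x \<in> C" using assms(2) by (simp add: denting_point_def)
next
  fix a b assume ab: "a \<in> C" "b \<in> C" and x: "x \<in> open_segment a b"
  have neq: "x \<noteq> a" "x \<noteq> b" using x by (auto simp: open_segment_def)
  define \<epsilon> where "\<epsilon> = min (dist x a) (dist x b)"
  have "\<epsilon> > 0" using neq by (simp add: \<epsilon>_def)
  then obtain f \<alpha> where f: "x \<in> slice C f \<alpha>" "diameter (slice C f \<alpha>) < \<epsilon>"
    using assms(2) unfolding denting_point_def by blast
  have "bounded (slice C f \<alpha>)" using assms(1) by (rule bounded_subset) (auto simp: slice_def)
  then have no: "c \<notin> slice C f \<alpha>" if "dist x c \<ge> \<epsilon>" for c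
    using diameter_bounded_bound[OF _ f(1), of c] f(2) that by force
  let ?m = "(SUP y\<in>C. f y) - \<alpha>"
  have le: "f a \<le> ?m" "f b \<le> ?m" using no[of a] no[of b] ab by (auto simp: slice_def \<epsilon>_def)
  obtain t where t: "0 < t" "t < 1" "x = (1 - t) *\<^sub>R a + t *\<^sub>R b"
    using x by (auto simp: in_segment)
  have "f x = (1 - t) * f a + t * f b" by (simp add: t(3) blinfun.bilinear_simps)
  also have "\<dots> \<le> (1 - t) * ?m + t * ?m" using t le by (intro add_mono mult_left_mono) auto
  also have "\<dots> = ?m" by (simp add: algebra_simps)
  finally show False using f(1) by (simp add: slice_def)
qed

lemma uniformly_convex_set_zero_mem:
  assumes "uniformly_convex_set K" "K \<noteq> {}"
  shows "0 \<in> K"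
proof -
  obtain y where y: "y \<in> K" "- y \<in> K" using assms by (auto simp: uniformly_convex_set_def)
  have "convex K" using assms(1) by (simp add: uniformly_convex_set_def)
  from convexD[OF this y, of "1 / 2" "1 / 2"] show ?thesis by simp
qed

lemma extreme_point_imp_denting_point:
  assumes K: "uniformly_convex_set K" and nz: "K \<noteq> {0}" and x: "x extreme_point_of K"
  shows "denting_point x K"
  unfolding denting_point_def
proof (intro conjI allI impI)
  show xK: "x \<in> K" using x by (simp add: extreme_point_of_def)
  have K': "bounded K" "closed K" "convex K" "\<And>y. y \<in> K \<Longrightarrow> - y \<in> K"
    using K by (auto simp: uniformly_convex_set_def)
  have zero: "0 \<in> K" using uniformly_convex_set_zero_mem[OF K] xK by auto
  \<comment> \<open>The origin is the midpoint of \<open>y\<close> and \<open>- y\<close> for a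
    nonzero \<open>y \<in> K\<close>, so it is not extreme.\<close>
  have "x \<noteq> 0"
  proof
    assume "x = 0"
    obtain y where y: "y \<in> K" "y \<noteq> 0" using zero nz by auto
    have "midpoint y (- y) \<in> open_segment y (- y)" using y by (simp add: real_vector_eq_minus_iff)
    then show False using x y K'(4) \<open>x = 0\<close> by (auto simp: extreme_point_of_def midpoint_def)
  qed
  fix \<epsilon> :: real assume "\<epsilon> > 0"
  \<comment> \<open>Half of \<epsilon> is used because the slice bound is weak, while a denting
    point needs diameter strictly below \<epsilon>.\<close>
  then obtain \<delta> where \<delta>: "0 < \<delta>" "\<delta> < 1"
    "\<And>f y z. y \<in> slice K f (\<delta> * (SUP w\<in>K. blinfun_apply f w)) \<Longrightarrow>
       z \<in> slice K f (\<delta> * (SUP w\<in>K. blinfun_apply f w)) \<Longrightarrow> norm (y - z) \<le> \<epsilon> / 2"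
    using uniformly_convex_set_slice[OF K, of "\<epsilon> / 2"] by auto
  have "x \<notin> (\<lambda>w. (1 - \<delta>) *\<^sub>R w) ` K"
  proof
    assume "x \<in> (\<lambda>w. (1 - \<delta>) *\<^sub>R w) ` K"
    then obtain w where w: "w \<in> K" "x = (1 - \<delta>) *\<^sub>R w" by auto
    then have "x \<in> open_segment 0 w" using \<delta> \<open>x \<noteq> 0\<close>
      by (auto simp: in_segment intro!: exI[of _ "1 - \<delta>"])
    then show False using x w zero by (auto simp: extreme_point_of_def)
  qed
  then obtain f :: "'a \<Rightarrow>\<^sub>L real" and d where f: "0 < d"
    "\<And>y. y \<in> (\<lambda>w. (1 - \<delta>) *\<^sub>R w) ` K \<Longrightarrow> f y + d \<le> f x"
    using separation_point_closed_convex[of "(\<lambda>w. (1 - \<delta>) *\<^sub>R w) ` K" x] K' zero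
    by (metis closed_scaling convex_scaling empty_iff image_is_empty)
  define M where "M = (SUP w\<in>K. f w)"
  \<comment> \<open>Rescaling the separation gives \<open>(1 - \<delta>) * M \<le> f x - d\<close>;
    the gap \<open>d\<close> makes the slice inequality at \<open>x\<close> strict.\<close>
  have "f w \<le> (f x - d) / (1 - \<delta>)" if "w \<in> K" for w
    using f(2)[of "(1 - \<delta>) *\<^sub>R w"] that \<delta> by (auto simp: blinfun.bilinear_simps field_simps)
  then have "M \<le> (f x - d) / (1 - \<delta>)" unfolding M_def using zero by (intro cSUP_least) auto
  then have gt: "f x > M - \<delta> * M" using \<delta> f(1) by (simp add: field_simps)
  moreover have "f x \<le> M"
    unfolding M_def using xK K'(1) by (intro cSUP_upper bdd_above_blinfun_image)
  \<comment> \<open>The width of the slice is positive because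
    \<open>M - \<delta> * M < f x \<le> M\<close>.\<close>
  ultimately have "\<delta> * M > 0" by simp
  moreover have "x \<in> slice K f (\<delta> * M)" using gt xK by (simp add: slice_def M_def)
  moreover have "diameter (slice K f (\<delta> * M)) \<le> \<epsilon> / 2"
    using \<delta>(3) \<open>\<epsilon> > 0\<close> unfolding M_def by (intro diameter_le) auto
  ultimately show "\<exists>f \<alpha>. \<alpha> > 0 \<and> x \<in> slice K f \<alpha> \<and> diameter (slice K f \<alpha>) < \<epsilon>"
    using \<open>\<epsilon> > 0\<close> by (intro exI[of _ f] exI[of _ "\<delta> * M"]) auto
qed

section \<open>Exposed and strongly exposed points\<close>

lemma exposes_symmetric_imp_sup:
  fixes f :: "'a::real_normed_vector \<Rightarrow>\<^sub>L real"
  assumes sym: "\<And>y. y \<in> K \<Longrightarrow> - y \<in> K" and nz: "K \<noteq> {0}" and f: "exposes f x K"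
  shows "(SUP y\<in>K. f y) = f x" "f x > 0"
proof -
  have x: "x \<in> K" and lt: "\<And>y. y \<in> K \<Longrightarrow> y \<noteq> x \<Longrightarrow> f y < f x"
    using f by (auto simp: exposes_def)
  show "(SUP y\<in>K. f y) = f x"
  proof (rule cSup_eq_maximum)
    show "f x \<in> blinfun_apply f ` K" using x by simp
  next
    fix t assume "t \<in> blinfun_apply f ` K"
    then show "t \<le> f x" using lt by force
  qed
  \<comment> \<open>The distinct points \<open>y\<close> and \<open>- y\<close> cannot both attain
    the value \<open>f x\<close>, and neither exceeds it; adding the two inequalities, one of them
    strict, gives \<open>0 < 2 * f x\<close>.\<close>
  obtain y where y: "y \<in> K" "y \<noteq> - y" using x nz by (auto simp: real_vector_eq_minus_iff)
  have "f y \<noteq> f x \<or> f (- y) \<noteq> f x" using lt[of y] lt[of "- y"] y sym by (metis less_irrefl)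
  moreover have "f z \<le> f x" if "z \<in> K" for z using lt[of z] that by force
  ultimately show "f x > 0"
    using y(1) sym[OF y(1)] by (smt (verit) blinfun.minus_right)
qed

text \<open>Since \<open>f x\<close> is the positive supremum, \<open>x\<close> lies in each slice
  of width \<open>\<delta> * f x\<close>, so points of \<open>K\<close> with value near
  \<open>f x\<close> are near \<open>x\<close>. Both conclusions follow from this.\<close>

lemma sup_imp_strongly_exposed:
  fixes f :: "'a::real_normed_vector \<Rightarrow>\<^sub>L real"
  assumes K: "uniformly_convex_set K" and x: "x \<in> K"
    and sup: "(SUP y\<in>K. f y) = f x" and pos: "f x > 0"
  shows "exposes f x K"
    and "\<And>s :: nat \<Rightarrow> 'a. (\<And>n. s n \<in> K) \<Longrightarrow>
           (\<lambda>n. f (s n)) \<longlonglongrightarrow> f x \<Longrightarrow> s \<longlonglongrightarrow> x"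
proof -
  have near: "\<exists>\<alpha>>0. \<forall>y\<in>K. f y > f x - \<alpha> \<longrightarrow> norm (y - x) \<le> \<epsilon>" if \<epsilon>: "\<epsilon> > 0" for \<epsilon>
  proof -
    obtain \<delta> where \<delta>: "0 < \<delta>" "\<delta> < 1"
      "\<And>f y z. y \<in> slice K f (\<delta> * (SUP w\<in>K. blinfun_apply f w)) \<Longrightarrow>
         z \<in> slice K f (\<delta> * (SUP w\<in>K. blinfun_apply f w)) \<Longrightarrow> norm (y - z) \<le> \<epsilon>"
      using uniformly_convex_set_slice[OF K \<epsilon>] by metis
    have "norm (y - x) \<le> \<epsilon>" if "y \<in> K" "f y > f x - \<delta> * f x" for y
      using \<delta>(3)[of y f x] that x \<delta>(1) pos by (simp add: slice_def sup)
    then show ?thesis using \<delta>(1) pos by (intro exI[of _ "\<delta> * f x"]) auto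
  qed
  show "exposes f x K"
    unfolding exposes_def
  proof (intro conjI ballI x)
    fix y assume y: "y \<in> K - {x}"
    show "f y < f x"
    proof (rule ccontr)
      assume "\<not> f y < f x"
      \<comment> \<open>A \<open>y\<close> with \<open>f y \<ge> f x\<close> passes every threshold,
        so its distance to \<open>x\<close> would be at most half of itself.\<close>
      then show False using near[of "norm (y - x) / 2"] y by force
    qed
  qed
  fix s :: "nat \<Rightarrow> 'a" assume s: "\<And>n. s n \<in> K" "(\<lambda>n. f (s n)) \<longlonglongrightarrow> f x"
  show "s \<longlonglongrightarrow> x"
  proof (rule tendstoI)
    fix \<epsilon> :: real assume "\<epsilon> > 0"
    then obtain \<alpha> where \<alpha>: "\<alpha> > 0" "\<And>y. y \<in> K \<Longrightarrow> f y > f x - \<alpha> \<Longrightarrow> norm (y - x) \<le> \<epsilon> / 2"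
      using near[of "\<epsilon> / 2"] by auto
    have "\<forall>\<^sub>F n in sequentially. f (s n) > f x - \<alpha>"
      using order_tendstoD(1)[OF s(2)] \<alpha>(1) by simp
    then show "\<forall>\<^sub>F n in sequentially. dist (s n) x < \<epsilon>"
    proof eventually_elim
      case (elim n)
      then show ?case using \<alpha>(2)[OF s(1) elim] \<open>\<epsilon> > 0\<close> by (simp add: dist_norm)
    qed
  qed
qed

theorem proposition4p12:
  fixes K :: "'a::banach set" and Z :: "('a \<Rightarrow>\<^sub>L real) set"
  assumes "uniformly_convex_set K" and "K \<noteq> {0}" and "subspace Z"
  shows "{x. x extreme_point_of K} = {x. denting_point x K}
    \<and> {x. exposed_point Z x K} = {x. strongly_exposed_point Z x K}
    \<and> {x. strongly_exposed_point Z x K} =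
        {x \<in> K. \<exists>f\<in>Z. (SUP y\<in>K. blinfun_apply f y) = blinfun_apply f x \<and> blinfun_apply f x > 0}"
proof -
  have K: "bounded K" "\<And>y. y \<in> K \<Longrightarrow> - y \<in> K"
    using assms(1) by (auto simp: uniformly_convex_set_def)
  have ext: "x extreme_point_of K \<longleftrightarrow> denting_point x K" for x
    using extreme_point_imp_denting_point[OF assms(1,2)] denting_point_imp_extreme_point[OF K(1)]
    by blast
  let ?P = "\<lambda>x. x \<in> K \<and> (\<exists>f\<in>Z. (SUP y\<in>K. blinfun_apply f y) = blinfun_apply f x \<and> blinfun_apply f x > 0)"
  \<comment> \<open>The sets in (b) are compared by a cycle of three implications, in which the
    witnessing functional stays the same.\<close>
  have "strongly_exposed_point Z x K \<Longrightarrow> exposed_point Z x K" for x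
    by (auto simp: strongly_exposed_point_def exposed_point_def)
  moreover have "exposed_point Z x K \<Longrightarrow> ?P x" for x
    using exposes_symmetric_imp_sup[OF K(2) assms(2)]
    unfolding exposed_point_def by (metis exposes_def)
  moreover have "?P x \<Longrightarrow> strongly_exposed_point Z x K" for x
    using sup_imp_strongly_exposed[OF assms(1)] unfolding strongly_exposed_point_def by metis
  ultimately show ?thesis using ext by blast
qed

end
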